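(* Let $G$ be a discrete group, $L\ge1$, and $\mathcal T\in\mathrm{Aut}(G)$ with $\mathcal T^L=\mathrm{id}$. Let $g\mapsto U_g$ be a (linear) unitary representation of $G$ on $\mathbb C^d$, and set $U_{g,j}=U_{\mathcal T^{j-1}(g)}$ and $\mathcal U_g=\bigotimes_{j=1}^L U_{g,j}$. Let $A$ be a left-canonical injective MPS tensor such that for all $g\in G$ and all positive integers $k$ the periodic MPS $|\psi_{kL}\rangle$ is an eigenstate of $\mathcal U_g^{\otimes k}$. For each $g\in G$ let $v_0(g),\dots,v_L(g)$ be bond unitaries with $v_0(g)\doteq v_L(g)$ and $$U_{g,j}\cdot A\doteq v_{j-1}(g)^\dagger A\,v_j(g),\qquad 1\le j\le L .$$ Then: 1. $v_j(g)\doteq v_{j-1}(\mathcal T(g))$ for all $g\in G$, $1\le j\le L$. 2. For each $j$ there is a $U(1)$-valued 2-cocycle $\omega_j$ on $G$ with $v_j(g)v_j(h)=\omega_j(g,h)v_j(gh)$ for all $g,h\in G$. 3. The class $[\omega_j]\in H^2(G,U(1))$ is independent of $j$, and the common class $[\omega]$ satisfies $\omega(g,h)=\omega(\mathcal T(g),\mathcal T(h))$ up to coboundaries, i.e. $[\omega]=[\mathcal T^*\omega]$ in $H^2(G,U(1))$.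
   Context: An MPS tensor is a tuple $A=(A^s)_{s=1}^d$ of complex $\chi\times\chi$ matrices. The periodic MPS on $M$ sites is $|\psi_M\rangle=\sum_{s_1,\dots,s_M}\mathrm{Tr}(A^{s_1}\cdots A^{s_M})|s_1\dots s_M\rangle$. The transfer channel is $\mathcal E(X)=\sum_s (A^s)^\dagger X A^s$. Left-canonical injective means: $\mathcal E(\mathbb 1)=\mathbb 1$; there is a positive definite $\rho$ with $\mathrm{Tr}\,\rho=1$ and $\sum_s A^s\rho (A^s)^\dagger=\rho$; and $1$ is a simple eigenvalue of $\mathcal E$ with all other eigenvalues of modulus strictly less than $1$. $(U\cdot A)^s=\sum_{s'}U_{ss'}A^{s'}$. The symbol $\doteq$ denotes equality up to a phase (modulus-one scalar, independent of the physical index). "Eigenstate of $\mathcal U$" means $\mathcal U|\psi\rangle=e^{i\theta}|\psi\rangle$ for some real $\theta$. Here $G$ acts trivially on $U(1)$ in $H^2(G,U(1))$, and $(\mathcal T^*\omega)(g,h)=\omega(\mathcal T(g),\mathcal T(h))$. Bond unitaries are unitary $\chi\times\chi$ matrices; unitaries $v_j(g)$ with the stated push-through property exist. *)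

theory Defs
  imports "HOL-Analysis.Analysis" "HOL-Algebra.Coset"
begin

subsection \<open>Complex matrices\<close>

text \<open>
  On \<open>complex^'n^'n\<close> the library only offers real scalar multiplication \<open>*\<^sub>R\<close>, and \<open>*\<close> is the
  entrywise product; the matrix product is \<open>**\<close>.
\<close>

definition mat_scale :: "complex \<Rightarrow> complex^'n^'m \<Rightarrow> complex^'n^'m" (infixr \<open>*\<^sub>m\<close> 75)
  where "c *\<^sub>m X = (\<chi> i j. c * X $ i $ j)"

definition dagger :: "complex^'n^'m \<Rightarrow> complex^'m^'n"
  where "dagger X = (\<chi> i j. cnj (X $ j $ i))"

definition unitary_mat :: "complex^'n^'n \<Rightarrow> bool"
  where "unitary_mat V \<longleftrightarrow> dagger V ** V = mat 1 \<and> V ** dagger V = mat 1"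

definition pos_def :: "complex^'n^'n \<Rightarrow> bool"
  where "pos_def \<rho> \<longleftrightarrow> dagger \<rho> = \<rho> \<and>
    (\<forall>x. x \<noteq> 0 \<longrightarrow> 0 < Re (\<Sum>i\<in>UNIV. \<Sum>j\<in>UNIV. cnj (x $ i) * \<rho> $ i $ j * x $ j))"

definition phase_eq :: "complex^'n^'m \<Rightarrow> complex^'n^'m \<Rightarrow> bool" (infix \<open>\<doteq>\<close> 50)
  where "X \<doteq> Y \<longleftrightarrow> (\<exists>c. cmod c = 1 \<and> X = c *\<^sub>m Y)"

definition eigval :: "(complex^'n^'m \<Rightarrow> complex^'n^'m) \<Rightarrow> complex \<Rightarrow> bool"
  where "eigval f z \<longleftrightarrow> (\<exists>X. X \<noteq> 0 \<and> f X = z *\<^sub>m X)"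

text \<open>
  An eigenvalue is simple if its algebraic multiplicity, i.e. the complex dimension of its
  generalized eigenspace, is 1.
\<close>

definition gen_eigenspace ::
    "(complex^'n^'m \<Rightarrow> complex^'n^'m) \<Rightarrow> complex \<Rightarrow> (complex^'n^'m) set"
  where "gen_eigenspace f z = {X. \<exists>n. ((\<lambda>Y. f Y - z *\<^sub>m Y) ^^ n) X = 0}"

definition simple_eigval :: "(complex^'n^'m \<Rightarrow> complex^'n^'m) \<Rightarrow> complex \<Rightarrow> bool"
  where "simple_eigval f z \<longleftrightarrow>
    (\<exists>X. X \<noteq> 0 \<and> gen_eigenspace f z = range (\<lambda>c. c *\<^sub>m X))"


subsection \<open>Matrix product states\<close>

text \<open>
  \<open>'d\<close> indexes the basis of the physical space and \<open>'x\<close> that of the bond space.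
\<close>

type_synonym ('d, 'x) mps_tensor = "'d \<Rightarrow> complex^'x^'x"

definition transfer_channel ::
    "('d::finite, 'x::finite) mps_tensor \<Rightarrow> complex^'x^'x \<Rightarrow> complex^'x^'x"
  where "transfer_channel A X = (\<Sum>s\<in>UNIV. dagger (A s) ** X ** A s)"

definition left_canonical_injective :: "('d::finite, 'x::finite) mps_tensor \<Rightarrow> bool"
  where "left_canonical_injective A \<longleftrightarrow>
    transfer_channel A (mat 1) = mat 1 \<and>
    (\<exists>\<rho>. pos_def \<rho> \<and> trace \<rho> = 1 \<and> (\<Sum>s\<in>UNIV. A s ** \<rho> ** dagger (A s)) = \<rho>) \<and>
    simple_eigval (transfer_channel A) 1 \<and>
    (\<forall>z. eigval (transfer_channel A) z \<and> z \<noteq> 1 \<longrightarrow> cmod z < 1)"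

definition phys_act ::
    "complex^'d^'d \<Rightarrow> ('d::finite, 'x::finite) mps_tensor \<Rightarrow> ('d, 'x) mps_tensor"
  where "phys_act W A = (\<lambda>s. \<Sum>s'\<in>UNIV. (W $ s $ s') *\<^sub>m A s')"

definition tensor_phase_eq ::
    "('d::finite, 'x::finite) mps_tensor \<Rightarrow> ('d, 'x) mps_tensor \<Rightarrow> bool" (infix \<open>\<doteq>\<^sub>t\<close> 50)
  where "A \<doteq>\<^sub>t B \<longleftrightarrow> (\<exists>c. cmod c = 1 \<and> (\<forall>s. A s = c *\<^sub>m B s))"

text \<open>
  A vector of the \<open>M\<close>-fold tensor power of \<open>\<complex>\<^sup>d\<close> is given by its coefficients in the product basis,
  as a function on lists that vanishes on lists whose length is not \<open>M\<close>.
\<close>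

type_synonym 'd state = "'d list \<Rightarrow> complex"

definition mps_state :: "('d::finite, 'x::finite) mps_tensor \<Rightarrow> nat \<Rightarrow> 'd state"
  where "mps_state A M =
    (\<lambda>s. if length s = M then trace (foldr (**) (map A s) (mat 1)) else 0)"

text \<open>
  The action of \<open>W\<^sub>1 \<otimes> \<dots> \<otimes> W\<^sub>M\<close>, where \<open>Ws = [W\<^sub>1, \<dots>, W\<^sub>M]\<close>.  A tensor product of such operators
  corresponds to concatenation of the lists.
\<close>

definition tensor_op :: "(complex^'d^'d) list \<Rightarrow> 'd::finite state \<Rightarrow> 'd state"
  where "tensor_op Ws \<psi> =
    (\<lambda>s. if length s = length Ws
         then \<Sum>s' | length s' = length Ws. (\<Prod>i<length Ws. Ws ! i $ (s ! i) $ (s' ! i)) * \<psi> s'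
         else 0)"

definition eigenstate :: "('d state \<Rightarrow> 'd state) \<Rightarrow> 'd state \<Rightarrow> bool"
  where "eigenstate Op \<psi> \<longleftrightarrow> (\<exists>\<theta>::real. Op \<psi> = (\<lambda>s. exp (\<i> * of_real \<theta>) * \<psi> s))"


subsection \<open>The modulated symmetry\<close>

definition unitary_rep :: "('g, 'm) monoid_scheme \<Rightarrow> ('g \<Rightarrow> complex^'d^'d) \<Rightarrow> bool"
  where "unitary_rep G U \<longleftrightarrow>
    (\<forall>g\<in>carrier G. unitary_mat (U g)) \<and> U \<one>\<^bsub>G\<^esub> = mat 1 \<and>
    (\<forall>g\<in>carrier G. \<forall>h\<in>carrier G. U (g \<otimes>\<^bsub>G\<^esub> h) = U g ** U h)"

definition site_rep :: "('g \<Rightarrow> complex^'d^'d) \<Rightarrow> ('g \<Rightarrow> 'g) \<Rightarrow> 'g \<Rightarrow> nat \<Rightarrow> complex^'d^'d"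
  where "site_rep U T g j = U ((T ^^ (j - 1)) g)"

text \<open>The tensor factors of \<open>\<U>\<^sub>g\<close>, and the \<open>k\<close>-fold tensor power of \<open>\<U>\<^sub>g\<close>.\<close>

definition cell_factors ::
    "('g \<Rightarrow> complex^'d^'d) \<Rightarrow> ('g \<Rightarrow> 'g) \<Rightarrow> nat \<Rightarrow> 'g \<Rightarrow> (complex^'d^'d) list"
  where "cell_factors U T L g = map (site_rep U T g) [1..<L + 1]"

definition cell_power_op ::
    "('g \<Rightarrow> complex^'d^'d) \<Rightarrow> ('g \<Rightarrow> 'g) \<Rightarrow> nat \<Rightarrow> nat \<Rightarrow> 'g \<Rightarrow> 'd::finite state \<Rightarrow> 'd state"
  where "cell_power_op U T L k g = tensor_op (concat (replicate k (cell_factors U T L g)))"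


subsection \<open>The cohomology group $H^2(G, U(1))$ for the trivial action\<close>

text \<open>Two-cocycles are extensional functions on \<open>G \<times> G\<close>, so that equality is equality on \<open>G \<times> G\<close>.\<close>

abbreviation U1 :: "complex set"
  where "U1 \<equiv> sphere 0 1"

definition Z2 :: "('g, 'm) monoid_scheme \<Rightarrow> ('g \<times> 'g \<Rightarrow> complex) monoid"
  where "Z2 G = \<lparr>
    carrier = {\<omega> \<in> carrier G \<times> carrier G \<rightarrow>\<^sub>E U1.
      \<forall>g\<in>carrier G. \<forall>h\<in>carrier G. \<forall>k\<in>carrier G.
        \<omega> (g, h) * \<omega> (g \<otimes>\<^bsub>G\<^esub> h, k) = \<omega> (h, k) * \<omega> (g, h \<otimes>\<^bsub>G\<^esub> k)},
    mult = (\<lambda>\<omega> \<omega>'. \<lambda>p\<in>carrier G \<times> carrier G. \<omega> p * \<omega>' p),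
    one = (\<lambda>p\<in>carrier G \<times> carrier G. 1)\<rparr>"

definition coboundary :: "('g, 'm) monoid_scheme \<Rightarrow> ('g \<Rightarrow> complex) \<Rightarrow> 'g \<times> 'g \<Rightarrow> complex"
  where "coboundary G b =
    (\<lambda>(g, h)\<in>carrier G \<times> carrier G. b g * b h / b (g \<otimes>\<^bsub>G\<^esub> h))"

definition B2 :: "('g, 'm) monoid_scheme \<Rightarrow> ('g \<times> 'g \<Rightarrow> complex) set"
  where "B2 G = coboundary G ` (carrier G \<rightarrow> U1)"

definition H2 :: "('g, 'm) monoid_scheme \<Rightarrow> ('g \<times> 'g \<Rightarrow> complex) set monoid"
  where "H2 G = Z2 G Mod B2 G"

definition H2_class ::
    "('g, 'm) monoid_scheme \<Rightarrow> ('g \<times> 'g \<Rightarrow> complex) \<Rightarrow> ('g \<times> 'g \<Rightarrow> complex) set"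
  where "H2_class G \<omega> = B2 G #>\<^bsub>Z2 G\<^esub> \<omega>"

definition pullback ::
    "('g, 'm) monoid_scheme \<Rightarrow> ('g \<Rightarrow> 'g) \<Rightarrow> ('g \<times> 'g \<Rightarrow> complex) \<Rightarrow> 'g \<times> 'g \<Rightarrow> complex"
  where "pullback G T \<omega> = (\<lambda>(g, h)\<in>carrier G \<times> carrier G. \<omega> (T g, T h))"

lemma comm_group_Z2:
  fixes G (structure)
  assumes "group G"
  shows "comm_group (Z2 G)"
proof -
  interpret group G by fact
  show ?thesis
  proof (rule comm_groupI)
    fix x y assume x: "x \<in> carrier (Z2 G)" and y: "y \<in> carrier (Z2 G)"
    have "x (g, h) * y (g, h) * (x (g \<otimes> h, k) * y (g \<otimes> h, k)) =
        x (h, k) * y (h, k) * (x (g, h \<otimes> k) * y (g, h \<otimes> k))"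
      if "g \<in> carrier G" "h \<in> carrier G" "k \<in> carrier G" for g h k
    proof -
      have "x (g, h) * x (g \<otimes> h, k) = x (h, k) * x (g, h \<otimes> k)"
        and "y (g, h) * y (g \<otimes> h, k) = y (h, k) * y (g, h \<otimes> k)"
        using x y that by (auto simp: Z2_def)
      then show ?thesis by algebra
    qed
    then show "x \<otimes>\<^bsub>Z2 G\<^esub> y \<in> carrier (Z2 G)"
      using x y by (auto simp: Z2_def PiE_iff norm_mult)
  next
    show "\<one>\<^bsub>Z2 G\<^esub> \<in> carrier (Z2 G)"
      by (auto simp: Z2_def)
  next
    fix x assume x: "x \<in> carrier (Z2 G)"
    then show "\<one>\<^bsub>Z2 G\<^esub> \<otimes>\<^bsub>Z2 G\<^esub> x = x"
      by (auto simp: Z2_def PiE_iff extensional_def fun_eq_iff)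
    let ?y = "\<lambda>p\<in>carrier G \<times> carrier G. inverse (x p)"
    have "?y \<in> carrier (Z2 G)"
      using x by (auto simp: Z2_def PiE_iff norm_inverse simp flip: inverse_mult_distrib)
    moreover have "x p \<noteq> 0" if "p \<in> carrier G \<times> carrier G" for p
      using x that by (force simp: Z2_def PiE_iff)
    then have "?y \<otimes>\<^bsub>Z2 G\<^esub> x = \<one>\<^bsub>Z2 G\<^esub>"
      by (auto simp: Z2_def fun_eq_iff)
    ultimately show "\<exists>y\<in>carrier (Z2 G). y \<otimes>\<^bsub>Z2 G\<^esub> x = \<one>\<^bsub>Z2 G\<^esub>"
      by blast
  qed (auto simp: Z2_def fun_eq_iff)
qed

lemma coboundary_in_Z2:
  fixes G (structure)
  assumes "group G" and b: "b \<in> carrier G \<rightarrow> U1"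
  shows "coboundary G b \<in> carrier (Z2 G)"
proof -
  interpret group G by fact
  have "b g \<noteq> 0" and "norm (b g) = 1" if "g \<in> carrier G" for g
    using b that by (force simp: Pi_iff)+
  then show ?thesis
    by (auto simp: Z2_def coboundary_def norm_mult norm_divide field_simps m_assoc)
qed

lemma subgroup_B2:
  fixes G (structure)
  assumes "group G"
  shows "subgroup (B2 G) (Z2 G)"
proof -
  interpret group G by fact
  interpret Z: comm_group "Z2 G" by (rule comm_group_Z2) fact
  have mult: "coboundary G b \<otimes>\<^bsub>Z2 G\<^esub> coboundary G b' = coboundary G (\<lambda>g. b g * b' g)" for b b'
    by (auto simp: Z2_def coboundary_def fun_eq_iff)
  have one: "coboundary G (\<lambda>g. 1) = \<one>\<^bsub>Z2 G\<^esub>"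
    by (auto simp: Z2_def coboundary_def fun_eq_iff)
  show ?thesis
  proof (rule Z.subgroupI)
    show "B2 G \<subseteq> carrier (Z2 G)"
      using coboundary_in_Z2[OF assms] by (auto simp: B2_def)
    show "B2 G \<noteq> {}"
      by (auto simp: B2_def Pi_eq_empty intro!: exI[of _ 1])
  next
    fix x assume "x \<in> B2 G"
    then obtain b where b: "b \<in> carrier G \<rightarrow> U1" and x: "x = coboundary G b"
      by (auto simp: B2_def)
    let ?b = "\<lambda>g. inverse (b g)"
    have b': "?b \<in> carrier G \<rightarrow> U1"
      using b by (auto simp: Pi_iff norm_inverse)
    have "b g \<noteq> 0" if "g \<in> carrier G" for g
      using b that by (force simp: Pi_iff)
    then have "coboundary G (\<lambda>g. ?b g * b g) = coboundary G (\<lambda>g. 1)"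
      by (auto simp: coboundary_def fun_eq_iff)
    then have "inv\<^bsub>Z2 G\<^esub> x = coboundary G ?b"
      using mult[of ?b b] one x b b' coboundary_in_Z2[OF assms] by (intro Z.inv_equality) auto
    then show "inv\<^bsub>Z2 G\<^esub> x \<in> B2 G"
      using b' by (auto simp: B2_def)
  next
    fix x y assume "x \<in> B2 G" "y \<in> B2 G"
    then obtain b b' where "b \<in> carrier G \<rightarrow> U1" "b' \<in> carrier G \<rightarrow> U1"
      and "x = coboundary G b" "y = coboundary G b'"
      by (auto simp: B2_def)
    moreover from this have "(\<lambda>g. b g * b' g) \<in> carrier G \<rightarrow> U1"
      by (auto simp: Pi_iff norm_mult)
    ultimately show "x \<otimes>\<^bsub>Z2 G\<^esub> y \<in> B2 G"
      by (auto simp: B2_def mult)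
  qed
qed

lemma group_H2:
  fixes G (structure)
  assumes "group G"
  shows "group (H2 G)"
  unfolding H2_def
  using comm_group_Z2[OF assms] subgroup_B2[OF assms]
  by (simp add: comm_group.subgroup_imp_normal normal.factorgroup_is_group)

end

theory Submission
  imports Defs
begin

text \<open>
  The idea is that push-through unitaries are unique up to phases.  If \<open>v\<close> and \<open>w\<close> are two families
  for the same symmetry, then \<open>x\<^sub>j = v\<^sub>j w\<^sub>j\<^sup>\<dagger>\<close> satisfies \<open>\<E>(x\<^sub>j\<^sub>-\<^sub>1) \<doteq> x\<^sub>j\<close>, so \<open>x\<^sub>0\<close> is an eigenvector of \<open>\<E>\<^sup>L\<close>
  for an eigenvalue of modulus one.  Averaging over the \<open>L\<close>-th roots of this eigenvalue splits \<open>x\<^sub>0\<close>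
  into eigenvectors of \<open>\<E>\<close>, and only the eigenvalue 1, with eigenvector the identity, contributes.
  Uniqueness applied to \<open>v\<^sub>j\<^sub>-\<^sub>1(\<T>(g))\<close> gives part 1, and applied to \<open>v\<^sub>j(g) v\<^sub>j(h)\<close> it gives part 2.  For
  part 3, pushing \<open>U\<^sub>g U\<^sub>h = U\<^sub>g\<^sub>h\<close> through \<open>A\<close> shows that \<open>\<omega>\<^sub>j / \<omega>\<^sub>j\<^sub>-\<^sub>1\<close> is the coboundary of the
  push-through phases, because \<open>A \<noteq> 0\<close>.
\<close>

subsection \<open>Matrix algebra\<close>

lemma mat_scale_scale [simp]: "a *\<^sub>m (b *\<^sub>m X) = (a * b) *\<^sub>m X"
  by (simp add: mat_scale_def vec_eq_iff)

lemma mat_scale_one [simp]: "1 *\<^sub>m X = X"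
  by (simp add: mat_scale_def vec_eq_iff)

lemma mat_scale_zero [simp]: "0 *\<^sub>m X = 0" "a *\<^sub>m 0 = 0"
  by (simp_all add: mat_scale_def vec_eq_iff)

lemma mat_scale_eq_0_iff [simp]: "a *\<^sub>m X = 0 \<longleftrightarrow> a = 0 \<or> X = 0"
  by (auto simp: mat_scale_def vec_eq_iff)

lemma mat_scale_add: "a *\<^sub>m (X + Y) = a *\<^sub>m X + a *\<^sub>m Y"
  by (simp add: mat_scale_def vec_eq_iff algebra_simps)

lemma mat_scale_add_left: "(a + b) *\<^sub>m X = a *\<^sub>m X + b *\<^sub>m X"
  by (simp add: mat_scale_def vec_eq_iff algebra_simps)

lemma mat_scale_cancel: "a *\<^sub>m X = b *\<^sub>m X \<Longrightarrow> X \<noteq> 0 \<Longrightarrow> a = b"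
  by (auto simp: mat_scale_def vec_eq_iff)

lemma mat_scale_sum: "a *\<^sub>m (\<Sum>i\<in>I. F i) = (\<Sum>i\<in>I. a *\<^sub>m F i)"
  by (induction I rule: infinite_finite_induct) (simp_all add: mat_scale_add)

lemma mat_scale_sum_left: "(\<Sum>i\<in>I. a i) *\<^sub>m X = (\<Sum>i\<in>I. a i *\<^sub>m X)"
  by (induction I rule: infinite_finite_induct) (simp_all add: mat_scale_add_left)

lemma mat_scale_mult [simp]:
  "(a *\<^sub>m X) ** Y = a *\<^sub>m (X ** Y)" "X ** (a *\<^sub>m Y) = a *\<^sub>m (X ** Y)"
  by (simp_all add: mat_scale_def matrix_matrix_mult_def vec_eq_iff sum_distrib_left mult_ac)

lemma matrix_mult_zero [simp]: "X ** (0 :: complex^'n^'m) = 0" "(0 :: complex^'n^'m) ** Y = 0"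
  by (simp_all add: matrix_matrix_mult_def vec_eq_iff)

lemma matrix_mult_add_left: "(X + Y) ** (Z :: complex^'k^'n) = X ** Z + Y ** Z"
  by (simp add: matrix_matrix_mult_def vec_eq_iff algebra_simps sum.distrib)

lemma matrix_mult_sum_left: "(\<Sum>i\<in>I. F i) ** (Y :: complex^'k^'n) = (\<Sum>i\<in>I. F i ** Y)"
  by (induction I rule: infinite_finite_induct) (simp_all add: matrix_mult_add_left)

lemma matrix_mult_sum_right: "(X :: complex^'n^'k) ** (\<Sum>i\<in>I. F i) = (\<Sum>i\<in>I. X ** F i)"
  by (induction I rule: infinite_finite_induct) (simp_all add: matrix_add_ldistrib)

lemma dagger_scale [simp]: "dagger (a *\<^sub>m X) = cnj a *\<^sub>m dagger X"
  by (simp add: dagger_def mat_scale_def vec_eq_iff)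

lemma dagger_mult: "dagger (X ** Y) = dagger Y ** dagger X"
  by (simp add: dagger_def matrix_matrix_mult_def vec_eq_iff mult_ac)

lemma dagger_dagger [simp]: "dagger (dagger X) = X"
  by (simp add: dagger_def vec_eq_iff)

lemma mat_1_neq_0 [simp]: "(mat 1 :: complex^'n^'n) \<noteq> 0"
  by (simp add: mat_def vec_eq_iff)

lemma unitary_mat_cancel:
  assumes "unitary_mat V"
  shows "dagger V ** V = mat 1" "V ** dagger V = mat 1"
    "dagger V ** (V ** X) = X" "V ** (dagger V ** X) = X"
    "X ** V ** dagger V = X" "X ** dagger V ** V = X"
proof -
  show 1: "dagger V ** V = mat 1" "V ** dagger V = mat 1"
    using assms by (auto simp: unitary_mat_def)
  show "dagger V ** (V ** X) = X" "V ** (dagger V ** X) = X"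
    by (simp_all add: matrix_mul_assoc 1)
  show "X ** V ** dagger V = X" "X ** dagger V ** V = X"
    by (simp_all flip: matrix_mul_assoc add: 1)
qed

lemma unitary_mat_mult: "unitary_mat V \<Longrightarrow> unitary_mat W \<Longrightarrow> unitary_mat (V ** W)"
  by (simp add: unitary_mat_def dagger_mult) (metis matrix_mul_assoc matrix_mul_rid)

lemma unitary_mat_dagger: "unitary_mat V \<Longrightarrow> unitary_mat (dagger V)"
  by (simp add: unitary_mat_def)

lemma unitary_mat_1 [simp]: "unitary_mat (mat 1)"
proof -
  have "dagger (mat 1) = (mat 1 :: complex^'a^'a)"
    by (auto simp: dagger_def mat_def vec_eq_iff)
  then show ?thesis
    by (simp add: unitary_mat_def)
qed

lemma unitary_mat_nonzero: "unitary_mat V \<Longrightarrow> V \<noteq> 0"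
  by (auto simp: unitary_mat_def)

lemma cmod_1_cnj:
  assumes "cmod c = 1"
  shows "c * cnj c = 1" "cnj c * c = 1"
  using complex_norm_square[of c] assms by (simp_all add: mult.commute)

text \<open>Substituting into \<open>dagger V ** V = mat 1\<close> leaves \<open>cnj c * c\<close>
  times the identity.\<close>

lemma unitary_mat_scale_norm:
  assumes "unitary_mat V" "unitary_mat W" "V = c *\<^sub>m W"
  shows "cmod c = 1"
proof -
  have "(cnj c * c) *\<^sub>m mat 1 = (1 *\<^sub>m mat 1 :: complex^'a^'a)"
    using assms by (simp add: unitary_mat_def)
  then have "cnj c * c = 1"
    by (rule mat_scale_cancel) simp
  then have "complex_of_real ((cmod c)\<^sup>2) = 1"
    by (metis complex_norm_square mult.commute)
  then have "(cmod c)\<^sup>2 = 1"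
    using of_real_eq_1_iff by blast
  then show ?thesis
    by (simp add: power2_eq_1_iff) (smt (verit) norm_ge_zero)
qed

lemma phase_eq_refl [simp]: "X \<doteq> X"
  unfolding phase_eq_def by (rule exI[of _ 1]) simp

lemma phase_eq_sym: "X \<doteq> Y \<Longrightarrow> Y \<doteq> X"
proof -
  assume "X \<doteq> Y"
  then obtain c where "cmod c = 1" "X = c *\<^sub>m Y"
    by (auto simp: phase_eq_def)
  then show "Y \<doteq> X"
    unfolding phase_eq_def by (intro exI[of _ "cnj c"]) (simp add: cmod_1_cnj)
qed

lemma phase_eq_trans: "X \<doteq> Y \<Longrightarrow> Y \<doteq> Z \<Longrightarrow> X \<doteq> Z"
  unfolding phase_eq_def by (metis mat_scale_scale mult_1 norm_mult)

lemma phase_eq_mult: "X \<doteq> X' \<Longrightarrow> Y \<doteq> Y' \<Longrightarrow> X ** Y \<doteq> X' ** Y'"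
  unfolding phase_eq_def
proof (elim exE conjE)
  fix a b
  assume "cmod a = 1" "X = a *\<^sub>m X'" "cmod b = 1" "Y = b *\<^sub>m Y'"
  then show "\<exists>c. cmod c = 1 \<and> X ** Y = c *\<^sub>m (X' ** Y')"
    by (intro exI[of _ "a * b"]) (simp add: norm_mult mult.commute)
qed

lemma phase_eq_dagger: "X \<doteq> Y \<Longrightarrow> dagger X \<doteq> dagger Y"
  unfolding phase_eq_def by (metis complex_mod_cnj dagger_scale)

lemma phase_eq_unitaryI:
  assumes "unitary_mat V" "unitary_mat W" "V ** dagger W \<doteq> mat 1"
  shows "V \<doteq> W"
proof -
  from assms(3) obtain c where "cmod c = 1" and c: "V ** dagger W = c *\<^sub>m mat 1"
    by (auto simp: phase_eq_def)
  moreover have "V ** dagger W ** W = c *\<^sub>m W"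
    by (simp add: c)
  then have "V = c *\<^sub>m W"
    by (simp only: unitary_mat_cancel(6)[OF assms(2)])
  ultimately show ?thesis
    by (auto simp: phase_eq_def)
qed

lemma tensor_phase_eq_sym: "A \<doteq>\<^sub>t B \<Longrightarrow> B \<doteq>\<^sub>t A"
proof -
  assume "A \<doteq>\<^sub>t B"
  then obtain c where "cmod c = 1" "\<And>s. A s = c *\<^sub>m B s"
    by (auto simp: tensor_phase_eq_def)
  then show "B \<doteq>\<^sub>t A"
    unfolding tensor_phase_eq_def by (intro exI[of _ "cnj c"]) (simp add: cmod_1_cnj)
qed

lemma tensor_phase_eq_trans: "A \<doteq>\<^sub>t B \<Longrightarrow> B \<doteq>\<^sub>t C \<Longrightarrow> A \<doteq>\<^sub>t C"
  unfolding tensor_phase_eq_def by (metis mat_scale_scale mult_1 norm_mult)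

lemma tensor_phase_eq_conj:
  assumes "X \<doteq> X'" "Y \<doteq> Y'"
  shows "(\<lambda>s. dagger X ** A s ** Y) \<doteq>\<^sub>t (\<lambda>s. dagger X' ** A s ** Y')"
proof -
  from assms obtain a b where "cmod a = 1" "X = a *\<^sub>m X'" "cmod b = 1" "Y = b *\<^sub>m Y'"
    by (auto simp: phase_eq_def)
  then show ?thesis
    unfolding tensor_phase_eq_def by (intro exI[of _ "cnj a * b"]) (simp add: norm_mult mult.commute)
qed

subsection \<open>The peripheral spectrum of powers\<close>

text \<open>The numbers raised to the power \<open>k\<close> are the \<open>L\<close>-th roots of
  \<open>cis (- t)\<close>. Their \<open>k\<close>-th powers form a geometric progression in
  \<open>j\<close> whose ratio \<open>?w\<close> is an \<open>L\<close>-th root of unity, so the sum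
  vanishes once \<open>?w\<close> differs from 1.\<close>

lemma sum_cis_roots:
  assumes "0 < k" "k < L"
  shows "(\<Sum>j<L. cis (- (t + 2 * pi * real j) / real L) ^ k) = 0"
proof -
  let ?w = "cis (- (2 * pi * real k / real L))"
  have "cis (- (t + 2 * pi * real j) / real L) ^ k = cis (- t * real k / real L) * ?w ^ j" for j
  proof -
    have "real k * (- (t + 2 * pi * real j) / real L) =
        - t * real k / real L + real j * - (2 * pi * real k / real L)"
      using assms by (simp add: field_simps)
    then show ?thesis
      unfolding Complex.DeMoivre cis_mult by (rule arg_cong)
  qed
  moreover have "?w \<noteq> 1"
  \<comment> \<open>The ratio equals 1 only if \<open>L\<close> divides \<open>k\<close>, which
    \<open>0 < k < L\<close> excludes.\<close>
  proof
    assume "?w = 1"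
    then obtain n :: int where "- (2 * pi * real k / real L) = 2 * pi * n"
      by (auto simp: cis_conv_exp exp_eq_1 mult_ac)
    then have "2 * pi * real k = 2 * pi * - (of_int n * real L)"
      using assms by (simp add: field_simps)
    then have "real k = - (of_int n * real L)"
      by (simp only: mult_cancel_left) simp
    then have *: "int k = - n * int L"
      by (metis minus_mult_left of_int_eq_iff of_int_minus of_int_mult of_int_of_nat_eq)
    then have "int L dvd int k"
      by (metis dvd_triv_right)
    then show False
      using assms by (auto dest: dvd_imp_le)
  qed
  moreover have "?w ^ L = 1"
  proof -
    have "?w ^ L = cis (2 * pi * - real k)"
      using assms by (simp add: Complex.DeMoivre)
    also have "\<dots> = 1"
      by (rule cis_multiple_2pi) simp
    finally show ?thesis .
  qed
  ultimately show ?thesis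
    by (simp add: geometric_sum flip: sum_distrib_left)
qed

text \<open>On the span of the orbit of \<open>X\<close> the map \<open>f ^^ L\<close> is
  multiplication by \<mu>, so \<open>X\<close> is a sum of eigenvectors of \<open>f\<close> whose
  eigenvalues are \<open>L\<close>-th roots of \<mu>. These have modulus one, so by
  \<open>per\<close> every nonzero component has eigenvalue 1.\<close>

lemma power_eigenvector_fixed:
  fixes f :: "complex^'n^'m \<Rightarrow> complex^'n^'m"
  assumes add: "\<And>X Y. f (X + Y) = f X + f Y"
    and scale: "\<And>a X. f (a *\<^sub>m X) = a *\<^sub>m f X"
    and per: "\<And>z. eigval f z \<Longrightarrow> z \<noteq> 1 \<Longrightarrow> cmod z < 1"
    and L: "L \<ge> 1" and eig: "(f ^^ L) X = \<mu> *\<^sub>m X" and \<mu>: "cmod \<mu> = 1"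
  shows "f X = X"
proof -
  have f0: "f 0 = 0"
    using scale[of 0 0] by simp
  have fsum: "f (sum F I) = (\<Sum>i\<in>I. f (F i))" for F :: "nat \<Rightarrow> _" and I
    by (induction I rule: infinite_finite_induct) (simp_all add: f0 add)
  obtain t where t: "\<mu> = cis t"
    using \<mu> by (metis complex_norm_eq_1_exp cis_conv_exp)
  \<comment> \<open>The \<open>u j\<close> are the \<open>L\<close>-th roots of
    \<open>inverse \<mu>\<close>; then \<open>y j\<close> is \<open>L\<close> times the component of
    \<open>X\<close> for the eigenvalue \<open>inverse (u j)\<close>.\<close>
  define u where "u j = cis (- (t + 2 * pi * real j) / real L)" for j
  define y where "y j = (\<Sum>k<L. u j ^ k *\<^sub>m (f ^^ k) X)" for j
  have uL: "u j ^ L * \<mu> = 1" for j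
  proof -
    have "real L * (- (t + 2 * pi * real j) / real L) + t = 2 * pi * (- real j)"
      using L by simp
    then have "u j ^ L * \<mu> = cis (2 * pi * (- real j))"
      unfolding u_def t Complex.DeMoivre cis_mult by (rule arg_cong)
    also have "\<dots> = 1"
      by (rule cis_multiple_2pi) simp
    finally show ?thesis .
  qed
  have fy: "f (y j) = y j" for j
  proof -
    \<comment> \<open>Applying \<open>f\<close> and multiplying by \<open>u j\<close> shifts the
      summation index by one. The new top term is \<open>u j ^ L * \<mu>\<close> times
      \<open>X\<close>, that is \<open>X\<close>, and it replaces the lost term at 0; the summand
      \<open>X\<close> is carried along to avoid subtraction.\<close>
    have "u j *\<^sub>m f (y j) + X = (\<Sum>k<L. u j ^ Suc k *\<^sub>m (f ^^ Suc k) X) + X"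
      by (simp add: y_def fsum scale mat_scale_sum)
    also have "\<dots> = (\<Sum>k<Suc L. u j ^ k *\<^sub>m (f ^^ k) X)"
      by (subst sum.lessThan_Suc_shift) (simp add: add.commute)
    also have "\<dots> = y j + X"
      by (simp add: y_def eig uL)
    finally have uf: "u j *\<^sub>m f (y j) = y j"
      by simp
    have "u j * inverse (u j) = 1" and cm: "cmod (inverse (u j)) = 1"
      by (simp_all add: u_def norm_inverse del: cis_inverse)
    then have e: "f (y j) = inverse (u j) *\<^sub>m y j"
      by (metis mat_scale_one mat_scale_scale mult.commute uf)
    show ?thesis
    proof (cases "y j = 0")
      case False
      then have "eigval f (inverse (u j))"
        using e by (auto simp: eigval_def)
      then have "inverse (u j) = 1"
        using per cm by force
      then show ?thesis
        using e by simp
    qed (simp add: f0)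
  qed
  \<comment> \<open>Summing over all roots recovers \<open>X\<close>: after exchanging the sums,
    every power \<open>k > 0\<close> cancels by \<open>sum_cis_roots\<close> and
    \<open>k = 0\<close> contributes \<open>L\<close> copies.\<close>
  have "(\<Sum>j<L. y j) = (\<Sum>k<L. (\<Sum>j<L. u j ^ k) *\<^sub>m (f ^^ k) X)"
    unfolding y_def by (subst sum.swap) (simp add: mat_scale_sum_left)
  also have "\<dots> = (\<Sum>k<L. if k = 0 then of_nat L *\<^sub>m X else 0)"
    unfolding u_def by (intro sum.cong) (auto simp only: sum_cis_roots lessThan_iff
      power_0 sum_constant card_lessThan funpow_0 if_False if_True mult_1_right mat_scale_zero neq0_conv
      split: if_split)
  also have "\<dots> = of_nat L *\<^sub>m X"
    using L by simp
  finally have "f (of_nat L *\<^sub>m X) = of_nat L *\<^sub>m X"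
    by (metis (no_types, lifting) fsum fy sum.cong)
  then have "inverse (of_nat L) *\<^sub>m of_nat L *\<^sub>m f X = inverse (of_nat L) *\<^sub>m of_nat L *\<^sub>m X"
    by (simp only: scale)
  then show ?thesis
    using L by simp
qed

subsection \<open>Uniqueness of the push-through unitaries\<close>

lemma transfer_channel_add: "transfer_channel A (X + Y) = transfer_channel A X + transfer_channel A Y"
  by (simp add: transfer_channel_def matrix_add_ldistrib matrix_mult_add_left sum.distrib)

lemma transfer_channel_scale: "transfer_channel A (a *\<^sub>m X) = a *\<^sub>m transfer_channel A X"
  by (simp add: transfer_channel_def mat_scale_sum)

text \<open>A fixed point lies in the generalized eigenspace for 1, already with exponent 1. That
  space is a complex line, and it contains the identity because the channel is unital.\<close>

lemma transfer_channel_fixed_scalar: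
  assumes A: "left_canonical_injective A" and X: "transfer_channel A X = X"
  shows "\<exists>a. X = a *\<^sub>m mat 1"
proof -
  obtain Y where Y: "gen_eigenspace (transfer_channel A) 1 = range (\<lambda>c. c *\<^sub>m Y)"
    using A by (auto simp: left_canonical_injective_def simple_eigval_def)
  have "Z \<in> range (\<lambda>c. c *\<^sub>m Y)" if "transfer_channel A Z = Z" for Z
    unfolding Y[symmetric] gen_eigenspace_def using that by (auto intro!: exI[of _ 1])
  from this[OF X] this[of "mat 1"] obtain a b where a: "mat 1 = a *\<^sub>m Y" and b: "X = b *\<^sub>m Y"
    using A unfolding left_canonical_injective_def by blast
  have "a \<noteq> 0"
    using a mat_1_neq_0 by (metis mat_scale_zero(1))
  then show ?thesis
    by (intro exI[of _ "b / a"]) (simp add: a b)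
qed

text \<open>The zero tensor would give the zero channel, which is not unital. A nonzero
  \<open>A s\<close> later allows scalars in front of it to be compared.\<close>

lemma left_canonical_injective_nonzero:
  assumes "left_canonical_injective A"
  obtains s where "A s \<noteq> 0"
proof -
  have "transfer_channel A (mat 1) \<noteq> 0"
    using assms by (simp add: left_canonical_injective_def)
  moreover have "transfer_channel A (mat 1) = 0" if "\<And>s. A s = 0"
    using that by (simp add: transfer_channel_def)
  ultimately show ?thesis
    using that by blast
qed

text \<open>Only the agreement of the two conjugated tensors enters, not the operator that produced
  them, so the lemma applies equally to shifted families and to products. The two closing conditions
  turn the chain of \<open>L\<close> steps into a loop.\<close>

lemma push_through_unique:
  fixes A :: "('d::finite, 'x::finite) mps_tensor"
  assumes A: "left_canonical_injective A" and L: "L \<ge> 1"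
    and uv: "\<And>j. j \<le> L \<Longrightarrow> unitary_mat (v j)" and uw: "\<And>j. j \<le> L \<Longrightarrow> unitary_mat (w j)"
    and pv: "v 0 \<doteq> v L" and pw: "w 0 \<doteq> w L"
    and eq: "\<And>j. j < L \<Longrightarrow>
      (\<lambda>s. dagger (v j) ** A s ** v (Suc j)) \<doteq>\<^sub>t (\<lambda>s. dagger (w j) ** A s ** w (Suc j))"
    and j: "j \<le> L"
  shows "v j \<doteq> w j"
proof -
  let ?E = "transfer_channel A"
  define x where "x j = v j ** dagger (w j)" for j
  have ux: "unitary_mat (x j)" if "j \<le> L" for j
    using that by (simp add: x_def uv uw unitary_mat_mult unitary_mat_dagger)
  have step: "?E (x j) \<doteq> x (Suc j)" if "j < L" for j
  proof -
    obtain c where c: "cmod c = 1"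
      "\<And>s. dagger (v j) ** A s ** v (Suc j) = c *\<^sub>m (dagger (w j) ** A s ** w (Suc j))"
      using eq[OF \<open>j < L\<close>] by (auto simp: tensor_phase_eq_def)
    \<comment> \<open>Multiplying by \<open>v j\<close> on the left and
      \<open>dagger (w (Suc j))\<close> on the right turns the agreement into an intertwining
      relation, which moves \<open>x j\<close> past \<open>A s\<close> in the channel and leaves the
      channel applied to the identity.\<close>
    have "x j ** A s = cnj c *\<^sub>m A s ** x (Suc j)" for s
    proof -
      have "v j ** (dagger (v j) ** A s ** v (Suc j)) ** dagger (w (Suc j)) =
          c *\<^sub>m (v j ** (dagger (w j) ** A s ** w (Suc j)) ** dagger (w (Suc j)))"
        by (simp add: c)
      then have "A s ** x (Suc j) = c *\<^sub>m x j ** A s"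
        using \<open>j < L\<close> uv uw by (simp add: x_def matrix_mul_assoc unitary_mat_cancel)
      then show ?thesis
        by (simp add: cmod_1_cnj c)
    qed
    then have "?E (x j) = (\<Sum>s\<in>UNIV. cnj c *\<^sub>m (dagger (A s) ** mat 1 ** A s ** x (Suc j)))"
      unfolding transfer_channel_def by (intro sum.cong) (simp_all flip: matrix_mul_assoc)
    also have "\<dots> = cnj c *\<^sub>m (?E (mat 1) ** x (Suc j))"
      unfolding transfer_channel_def by (simp only: mat_scale_sum matrix_mult_sum_left)
    also have "?E (mat 1) = mat 1"
      using A by (simp add: left_canonical_injective_def)
    finally have "?E (x j) = cnj c *\<^sub>m x (Suc j)"
      by simp
    moreover have "cmod (cnj c) = 1"
      by (simp add: c(1))
    ultimately show ?thesis
      unfolding phase_eq_def by blast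
  qed
  have scale: "X \<doteq> Y \<Longrightarrow> ?E X \<doteq> ?E Y" for X Y
    unfolding phase_eq_def by (auto simp: transfer_channel_scale)
  have "(?E ^^ j) (x 0) \<doteq> x j" if "j \<le> L" for j
    using that
  proof (induction j)
    case 0
    show ?case
      by simp
  next
    case (Suc j)
    then have "?E ((?E ^^ j) (x 0)) \<doteq> ?E (x j)" "?E (x j) \<doteq> x (Suc j)"
      using scale step by simp_all
    then have "?E ((?E ^^ j) (x 0)) \<doteq> x (Suc j)"
      by (rule phase_eq_trans)
    then show ?case
      by simp
  qed
  then have "(?E ^^ L) (x 0) \<doteq> x L"
    by simp
  \<comment> \<open>Going once round the cell returns to \<open>x 0\<close> up to a phase, which
    makes \<open>x 0\<close> an eigenvector of the \<open>L\<close>-th power.\<close>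
  moreover have "x L \<doteq> x 0"
    unfolding x_def
    by (rule phase_eq_mult[OF phase_eq_sym[OF pv] phase_eq_dagger[OF phase_eq_sym[OF pw]]])
  ultimately have "(?E ^^ L) (x 0) \<doteq> x 0"
    by (rule phase_eq_trans)
  then obtain \<mu> where \<mu>: "cmod \<mu> = 1" "(?E ^^ L) (x 0) = \<mu> *\<^sub>m x 0"
    by (auto simp: phase_eq_def)
  have "cmod z < 1" if "eigval ?E z" "z \<noteq> 1" for z
    using A that by (auto simp: left_canonical_injective_def)
  then have "?E (x 0) = x 0"
    by (rule power_eigenvector_fixed[OF transfer_channel_add transfer_channel_scale _ L \<mu>(2,1)])
  then obtain a where a: "x 0 = a *\<^sub>m mat 1"
    using transfer_channel_fixed_scalar[OF A] by blast
  \<comment> \<open>The scalar \<open>a\<close> is a phase since \<open>x 0\<close> is unitary, and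
    unitality propagates this from each bond to the next.\<close>
  have "x j \<doteq> mat 1" if "j \<le> L" for j
    using that
  proof (induction j)
    case 0
    have "cmod a = 1"
      using ux[of 0] a by (intro unitary_mat_scale_norm[of "x 0" "mat 1"]) auto
    then show ?case
      using a by (auto simp: phase_eq_def)
  next
    case (Suc j)
    then have "x (Suc j) \<doteq> ?E (x j)" "?E (x j) \<doteq> ?E (mat 1)"
      using step[THEN phase_eq_sym] scale by simp_all
    then have "x (Suc j) \<doteq> ?E (mat 1)"
      by (rule phase_eq_trans)
    then show ?case
      using A by (simp add: left_canonical_injective_def)
  qed
  then show ?thesis
    using phase_eq_unitaryI[OF uv[OF j] uw[OF j]] j by (simp add: x_def)
qed

section \<open>Operators on the physical index\<close>

lemma phys_act_mult: "phys_act (V ** W) A = phys_act V (phys_act W A)"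
proof
  fix s
  have "phys_act V (phys_act W A) s = (\<Sum>i\<in>UNIV. \<Sum>k\<in>UNIV. (V $ s $ k * W $ k $ i) *\<^sub>m A i)"
    unfolding phys_act_def by (subst sum.swap) (simp add: mat_scale_sum)
  then show "phys_act (V ** W) A s = phys_act V (phys_act W A) s"
    by (simp add: phys_act_def matrix_matrix_mult_def mat_scale_sum_left)
qed

lemma phys_act_conj:
  "phys_act V (\<lambda>s. c *\<^sub>m X ** A s ** Y) s = c *\<^sub>m X ** phys_act V A s ** Y"
  by (simp add: phys_act_def matrix_mult_sum_left matrix_mult_sum_right mat_scale_sum mult.commute)

subsection \<open>Cohomology classes\<close>

lemma Z2_mult: "x \<otimes>\<^bsub>Z2 G\<^esub> y = (\<lambda>p\<in>carrier G \<times> carrier G. x p * y p)"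
  by (simp add: Z2_def)

text \<open>The last premise puts \<omega>' into the coset of \<omega>, and a coset is determined by
  any of its elements.\<close>

lemma H2_class_eqI:
  fixes G (structure)
  assumes "group G" "\<omega> \<in> carrier (Z2 G)" "\<omega>' \<in> carrier (Z2 G)" "b \<in> carrier G \<rightarrow> U1"
    and "\<And>g h. g \<in> carrier G \<Longrightarrow> h \<in> carrier G \<Longrightarrow> \<omega>' (g, h) = b g * b h / b (g \<otimes> h) * \<omega> (g, h)"
  shows "H2_class G \<omega>' = H2_class G \<omega>"
proof -
  interpret Z: comm_group "Z2 G"
    using assms(1) by (rule comm_group_Z2)
  have "\<omega>' = coboundary G b \<otimes>\<^bsub>Z2 G\<^esub> \<omega>"
    using assms(3,5) by (auto simp: Z2_def coboundary_def fun_eq_iff PiE_iff extensional_def)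
  then have "\<omega>' \<in> B2 G #>\<^bsub>Z2 G\<^esub> \<omega>"
    using assms(4) by (auto simp: r_coset_def B2_def)
  then show ?thesis
    using Z.repr_independence assms(2) subgroup_B2[OF assms(1)] by (metis H2_class_def)
qed

lemma H2_class_mem:
  assumes "\<omega>' \<in> H2_class G \<omega>"
  obtains b where "b \<in> carrier G \<rightarrow> U1"
    "\<omega>' = coboundary G b \<otimes>\<^bsub>Z2 G\<^esub> \<omega>"
  using assms by (auto simp: H2_class_def r_coset_def B2_def)

lemma pullback_Z2:
  fixes G (structure)
  assumes "T \<in> hom G G" "group G" "\<omega> \<in> carrier (Z2 G)"
  shows "pullback G T \<omega> \<in> carrier (Z2 G)"
proof -
  interpret group G by fact
  have T: "T g \<in> carrier G" "T (g \<otimes> h) = T g \<otimes> T h" if "g \<in> carrier G" "h \<in> carrier G" for g h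
    using assms(1) that by (auto simp: hom_def)
  show ?thesis
    using assms(3) T by (auto simp: Z2_def pullback_def PiE_iff)
qed

text \<open>\<open>W\<close> is pushed through first; \<open>V\<close> then acts on the physical
  index only and passes the bond matrices of \<open>W\<close>. The left factor
  \<open>dagger X' ** dagger X\<close> is the adjoint of \<open>X ** X'\<close>, so the order of
  multiplication is preserved on both bonds.\<close>

lemma phys_act_push_mult:
  assumes "\<And>s. phys_act V A s = a *\<^sub>m (dagger X ** A s ** Y)"
    and "\<And>s. phys_act W A s = b *\<^sub>m (dagger X' ** A s ** Y')"
  shows "phys_act (V ** W) A s = (a * b) *\<^sub>m (dagger (X ** X') ** A s ** (Y ** Y'))"
proof -
  have "phys_act W A = (\<lambda>s. b *\<^sub>m dagger X' ** A s ** Y')"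
    using assms(2) by (simp add: fun_eq_iff)
  then have "phys_act (V ** W) A s = b *\<^sub>m dagger X' ** phys_act V A s ** Y'"
    by (simp only: phys_act_mult phys_act_conj)
  then show ?thesis
    by (simp add: assms(1) dagger_mult matrix_mul_assoc mult.commute)
qed

text \<open>Unitarity forces modulus one. The cocycle identity compares the two bracketings of a
  triple product, whose common matrix is unitary, hence nonzero, and can be cancelled.\<close>

lemma projective_rep_cocycle:
  fixes G (structure)
  assumes "group G"
    and unit: "\<And>g. g \<in> carrier G \<Longrightarrow> unitary_mat (V g)"
    and mult: "\<And>g h. g \<in> carrier G \<Longrightarrow> h \<in> carrier G \<Longrightarrow> V g ** V h = \<omega> (g, h) *\<^sub>m V (g \<otimes> h)"
    and ext: "\<omega> \<in> extensional (carrier G \<times> carrier G)"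
  shows "\<omega> \<in> carrier (Z2 G)"
proof -
  interpret group G by fact
  have "cmod (\<omega> (g, h)) = 1" if "g \<in> carrier G" "h \<in> carrier G" for g h
    using unitary_mat_scale_norm[OF unitary_mat_mult[OF unit unit] unit mult] that by simp
  moreover have "\<omega> (g, h) * \<omega> (g \<otimes> h, k) = \<omega> (h, k) * \<omega> (g, h \<otimes> k)"
    if "g \<in> carrier G" "h \<in> carrier G" "k \<in> carrier G" for g h k
  proof -
    have "(\<omega> (g, h) * \<omega> (g \<otimes> h, k)) *\<^sub>m V (g \<otimes> h \<otimes> k) = V g ** V h ** V k"
      using that by (simp add: mult)
    also have "\<dots> = V g ** (V h ** V k)"
      by (simp add: matrix_mul_assoc)
    also have "\<dots> = (\<omega> (h, k) * \<omega> (g, h \<otimes> k)) *\<^sub>m V (g \<otimes> h \<otimes> k)"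
      using that by (simp add: mult m_assoc)
    finally show ?thesis
      using that by (intro mat_scale_cancel) (auto intro!: unitary_mat_nonzero unit)
  qed
  ultimately show ?thesis
    using ext by (auto simp: Z2_def PiE_iff)
qed

text \<open>Pullback acts on classes: since \<open>T\<close> is a homomorphism, the coboundary of
  \<open>b\<close> pulls back to the coboundary of \<open>b\<close> composed with
  \<open>T\<close>.\<close>

lemma H2_class_pullback:
  fixes G (structure)
  assumes G: "group G" and T: "T \<in> hom G G"
    and \<omega>: "\<omega> \<in> carrier (Z2 G)" and \<omega>': "\<omega>' \<in> H2_class G \<omega>"
  shows "H2_class G (pullback G T \<omega>') = H2_class G (pullback G T \<omega>)"
proof -
  interpret group G by fact
  interpret Z: comm_group "Z2 G"
    using G by (rule comm_group_Z2)
  obtain b where b: "b \<in> carrier G \<rightarrow> U1" and eq: "\<omega>' = coboundary G b \<otimes>\<^bsub>Z2 G\<^esub> \<omega>"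
    using \<omega>' by (rule H2_class_mem)
  have Z': "\<omega>' \<in> carrier (Z2 G)"
    using coboundary_in_Z2[OF G b] \<omega> by (simp add: eq)
  have TG: "T g \<in> carrier G" if "g \<in> carrier G" for g
    using T that by (rule hom_in_carrier)
  show ?thesis
  proof (rule H2_class_eqI[OF G pullback_Z2[OF T G \<omega>] pullback_Z2[OF T G Z']])
    show "(\<lambda>g. b (T g)) \<in> carrier G \<rightarrow> U1"
      using b TG by auto
    show "pullback G T \<omega>' (g, h) = b (T g) * b (T h) / b (T (g \<otimes> h)) * pullback G T \<omega> (g, h)"
      if "g \<in> carrier G" "h \<in> carrier G" for g h
      using that TG by (simp add: pullback_def eq Z2_mult coboundary_def hom_mult[OF T])
  qed
qed

subsection \<open>The theorem\<close>

theorem mainTheorem2: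
  fixes G :: "('g, 'm) monoid_scheme"
    and T :: "'g \<Rightarrow> 'g"
    and L :: nat
    and U :: "'g \<Rightarrow> complex^'d^'d"
    and A :: "('d::finite, 'x::finite) mps_tensor"
    and v :: "nat \<Rightarrow> 'g \<Rightarrow> complex^'x^'x"
  assumes "group G"
    and "L \<ge> 1"
    and "T \<in> iso G G"
    and "\<forall>g\<in>carrier G. (T ^^ L) g = g"
    and "unitary_rep G U"
    and "left_canonical_injective A"
    and "\<forall>g\<in>carrier G. \<forall>k\<ge>1. eigenstate (cell_power_op U T L k g) (mps_state A (k * L))"
    and "\<forall>g\<in>carrier G. \<forall>j\<le>L. unitary_mat (v j g)"
    and "\<forall>g\<in>carrier G. v 0 g \<doteq> v L g"
    and "\<forall>g\<in>carrier G. \<forall>j\<in>{1..L}.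
      phys_act (site_rep U T g j) A \<doteq>\<^sub>t (\<lambda>s. dagger (v (j - 1) g) ** A s ** v j g)"
  shows "(\<forall>g\<in>carrier G. \<forall>j\<in>{1..L}. v j g \<doteq> v (j - 1) (T g)) \<and>
    (\<exists>\<omega>.
      (\<forall>j\<le>L. \<omega> j \<in> carrier (Z2 G) \<and>
        (\<forall>g\<in>carrier G. \<forall>h\<in>carrier G.
          v j g ** v j h = \<omega> j (g, h) *\<^sub>m v j (g \<otimes>\<^bsub>G\<^esub> h))) \<and>
      (\<exists>c\<in>carrier (H2 G).
        (\<forall>j\<le>L. H2_class G (\<omega> j) = c) \<and>
        (\<forall>\<omega>'\<in>c. H2_class G (pullback G T \<omega>') = c)))"
proof -
  let ?C = "carrier G"
  interpret group G by fact
  interpret Z: comm_group "Z2 G"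
    using \<open>group G\<close> by (rule comm_group_Z2)
  note L = \<open>L \<ge> 1\<close> and A = \<open>left_canonical_injective A\<close>
  have T: "T \<in> hom G G"
    using \<open>T \<in> iso G G\<close> by (simp add: iso_def)
  have TG [simp]: "T g \<in> ?C" if "g \<in> ?C" for g
    using T that by (rule hom_in_carrier)
  have TnG: "(T ^^ j) g \<in> ?C" if "g \<in> ?C" for g j
    using that by (induction j) auto
  have TnM: "(T ^^ j) (g \<otimes>\<^bsub>G\<^esub> h) = (T ^^ j) g \<otimes>\<^bsub>G\<^esub> (T ^^ j) h" if "g \<in> ?C" "h \<in> ?C" for g h j
    using that by (induction j) (auto simp: TnG hom_mult[OF T])
  have uv: "unitary_mat (v j g)" if "g \<in> ?C" "j \<le> L" for g j
    using assms(8) that by blast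
  have pv: "v 0 g \<doteq> v L g" if "g \<in> ?C" for g
    using assms(9) that by blast
  \<comment> \<open>Sites are renumbered from 0, so site \<open>j\<close> lies between bonds
    \<open>j\<close> and \<open>Suc j\<close> and carries the power \<open>j\<close> of
    \<open>T\<close>.\<close>
  have push: "phys_act (U ((T ^^ j) g)) A \<doteq>\<^sub>t (\<lambda>s. dagger (v j g) ** A s ** v (Suc j) g)"
    if "g \<in> ?C" "j < L" for g j
    using assms(10) that by (force simp: site_rep_def dest!: bspec[of _ _ g] bspec[of _ _ "Suc j"])

  \<comment> \<open>Covariance of the bond unitaries under \<open>T\<close>\<close>
  have shift: "v (Suc j) g \<doteq> v j (T g)" if g: "g \<in> ?C" and j: "j < L" for g j
  proof -
    \<comment> \<open>The family of \<open>T g\<close> moved by one bond. Bond 0 wraps around to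
      bond \<open>L - 1\<close>, so that \<open>w 0\<close> and \<open>w L\<close> coincide.\<close>
    define w where "w j = (case j of 0 \<Rightarrow> v (L - 1) (T g) | Suc i \<Rightarrow> v i (T g))" for j
    have "v (Suc j) g \<doteq> w (Suc j)"
    proof (rule push_through_unique[OF A L])
      show "unitary_mat (v i g)" "unitary_mat (w i)" if "i \<le> L" for i
        using that g by (auto simp: uv w_def split: nat.split)
      show "v 0 g \<doteq> v L g"
        by (rule pv) fact
      show "w 0 \<doteq> w L"
        using L by (cases L) (simp_all add: w_def)
      show "Suc j \<le> L"
        using j by simp
      fix i assume i: "i < L"
      have "phys_act (U ((T ^^ i) g)) A \<doteq>\<^sub>t (\<lambda>s. dagger (w i) ** A s ** w (Suc i))"
      proof (cases i)
        case 0
        obtain n where n: "L = Suc n"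
          using L by (cases L) auto
        \<comment> \<open>Because \<open>T ^^ L\<close> is the identity, the last site for
          \<open>T g\<close> carries \<open>U g\<close>, the operator of the first site for
          \<open>g\<close>. Its right bond is \<open>v L (T g)\<close>, which is then exchanged for
          \<open>v 0 (T g)\<close> at the cost of a phase.\<close>
        have "(T ^^ n) (T g) = g"
          using assms(4) g by (simp add: n flip: funpow_swap1)
        then have "phys_act (U g) A \<doteq>\<^sub>t (\<lambda>s. dagger (v n (T g)) ** A s ** v L (T g))"
          using push[of "T g" n] g by (simp add: n)
        also have "\<dots> \<doteq>\<^sub>t (\<lambda>s. dagger (v n (T g)) ** A s ** v 0 (T g))"
          using g by (intro tensor_phase_eq_conj phase_eq_sym[OF pv] phase_eq_refl) simp
        finally (tensor_phase_eq_trans) show ?thesis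
          by (simp add: 0 w_def n)
      next
        case (Suc m)
        then show ?thesis
          using push[of "T g" m] i g by (simp add: w_def funpow_swap1)
      qed
      with push[OF g i] show "(\<lambda>s. dagger (v i g) ** A s ** v (Suc i) g) \<doteq>\<^sub>t
          (\<lambda>s. dagger (w i) ** A s ** w (Suc i))"
        by (blast intro: tensor_phase_eq_sym tensor_phase_eq_trans)
    qed
    then show ?thesis
      by (simp add: w_def)
  qed

  \<comment> \<open>Push-through phases and the projective multiplication law\<close>
  have "\<forall>j g. \<exists>z. j < L \<and> g \<in> ?C \<longrightarrow> cmod z = 1 \<and>
      (\<forall>s. phys_act (U ((T ^^ j) g)) A s = z *\<^sub>m (dagger (v j g) ** A s ** v (Suc j) g))"
    using push unfolding tensor_phase_eq_def by blast
  then obtain c where "\<forall>j g. j < L \<and> g \<in> ?C \<longrightarrow> cmod (c j g) = 1 \<and>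
      (\<forall>s. phys_act (U ((T ^^ j) g)) A s = c j g *\<^sub>m (dagger (v j g) ** A s ** v (Suc j) g))"
    by metis
  then have c: "cmod (c j g) = 1"
      "phys_act (U ((T ^^ j) g)) A s = c j g *\<^sub>m (dagger (v j g) ** A s ** v (Suc j) g)"
    if "g \<in> ?C" "j < L" for g j s
    using that by blast+
  \<comment> \<open>Both sides are the action of the same operator: the left pushes the factors for
    \<open>g\<close> and \<open>h\<close> separately, the right pushes their product.\<close>
  have push2: "(c j g * c j h) *\<^sub>m
        (dagger (v j g ** v j h) ** A s ** (v (Suc j) g ** v (Suc j) h)) =
      c j (g \<otimes>\<^bsub>G\<^esub> h) *\<^sub>m
        (dagger (v j (g \<otimes>\<^bsub>G\<^esub> h)) ** A s ** v (Suc j) (g \<otimes>\<^bsub>G\<^esub> h))"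
    if "g \<in> ?C" "h \<in> ?C" "j < L" for g h j s
  proof -
    have "U ((T ^^ j) (g \<otimes>\<^bsub>G\<^esub> h)) = U ((T ^^ j) g) ** U ((T ^^ j) h)"
      using assms(5) that by (simp add: unitary_rep_def TnG TnM)
    then show ?thesis
      using phys_act_push_mult[OF c(2) c(2), of g j h j s] c(2)[of "g \<otimes>\<^bsub>G\<^esub> h" j s] that by simp
  qed

  \<comment> \<open>The products \<open>v i g ** v i h\<close> and the matrices for the product
    element agree on the tensor by \<open>push2\<close>, so uniqueness applies.\<close>
  have mult: "v j g ** v j h \<doteq> v j (g \<otimes>\<^bsub>G\<^esub> h)" if g: "g \<in> ?C" and h: "h \<in> ?C" and j: "j \<le> L" for g h j
  proof (rule push_through_unique[OF A L _ _ _ _ _ j])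
    show "unitary_mat (v i g ** v i h)" "unitary_mat (v i (g \<otimes>\<^bsub>G\<^esub> h))" if "i \<le> L" for i
      using that g h by (simp_all add: uv unitary_mat_mult)
    show "v 0 g ** v 0 h \<doteq> v L g ** v L h" "v 0 (g \<otimes>\<^bsub>G\<^esub> h) \<doteq> v L (g \<otimes>\<^bsub>G\<^esub> h)"
      using g h by (simp_all add: pv phase_eq_mult)
    fix i assume i: "i < L"
    let ?z = "c i g * c i h"
    have z: "cmod ?z = 1" "cmod (c i (g \<otimes>\<^bsub>G\<^esub> h)) = 1"
      using g h i by (simp_all add: norm_mult c(1))
    have "dagger (v i g ** v i h) ** A s ** (v (Suc i) g ** v (Suc i) h) =
      (cnj ?z * c i (g \<otimes>\<^bsub>G\<^esub> h)) *\<^sub>m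
        (dagger (v i (g \<otimes>\<^bsub>G\<^esub> h)) ** A s ** v (Suc i) (g \<otimes>\<^bsub>G\<^esub> h))" for s
      using arg_cong[OF push2[OF g h i, of s], of "(*\<^sub>m) (cnj ?z)"]
      by (simp only: mat_scale_scale cmod_1_cnj(2)[OF z(1)] mat_scale_one)
    then show "(\<lambda>s. dagger (v i g ** v i h) ** A s ** (v (Suc i) g ** v (Suc i) h)) \<doteq>\<^sub>t
        (\<lambda>s. dagger (v i (g \<otimes>\<^bsub>G\<^esub> h)) ** A s ** v (Suc i) (g \<otimes>\<^bsub>G\<^esub> h))"
      unfolding tensor_phase_eq_def
      using z by (intro exI[of _ "cnj ?z * c i (g \<otimes>\<^bsub>G\<^esub> h)"]) (simp add: norm_mult)
  qed

  \<comment> \<open>The cocycles and their dependence on the bond\<close>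
  define \<omega> where "\<omega> j = (\<lambda>(g, h)\<in>?C \<times> ?C. SOME z. v j g ** v j h = z *\<^sub>m v j (g \<otimes>\<^bsub>G\<^esub> h))" for j
  have \<omega>: "v j g ** v j h = \<omega> j (g, h) *\<^sub>m v j (g \<otimes>\<^bsub>G\<^esub> h)" if "g \<in> ?C" "h \<in> ?C" "j \<le> L" for g h j
    using mult[OF that] that by (auto simp: \<omega>_def phase_eq_def intro: someI)
  \<comment> \<open>The chosen scalar is only known to satisfy the product equation; its modulus
    comes from unitarity, and the restricted abstraction supplies extensionality.\<close>
  have Z2: "\<omega> j \<in> carrier (Z2 G)" if "j \<le> L" for j
    by (rule projective_rep_cocycle[OF \<open>group G\<close>, of "v j"])
      (use that in \<open>auto simp: \<omega> uv\<close>, simp add: \<omega>_def)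
  have \<omega>1: "cmod (\<omega> j (g, h)) = 1" if "g \<in> ?C" "h \<in> ?C" "j \<le> L" for g h j
    using Z2[OF that(3)] that by (auto simp: Z2_def)

  have const: "H2_class G (\<omega> (Suc j)) = H2_class G (\<omega> j)" if j: "j < L" for j
  proof (rule H2_class_eqI[OF \<open>group G\<close>])
    show "\<omega> (Suc j) \<in> carrier (Z2 G)" "\<omega> j \<in> carrier (Z2 G)"
      using j by (simp_all add: Z2)
    \<comment> \<open>Inserting the cocycles into \<open>push2\<close> and comparing coefficients of
      \<open>?M\<close> below gives \<omega> at \<open>Suc j\<close> over \<omega> at
      \<open>j\<close> as \<open>c j (g \<otimes> h)\<close> over \<open>c j g * c j h\<close>. This
      is the coboundary of the inverse phases.\<close>
    show "(\<lambda>g. inverse (c j g)) \<in> ?C \<rightarrow> U1"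
      using j by (simp add: c norm_inverse)
    fix g h assume g: "g \<in> ?C" and h: "h \<in> ?C"
    obtain s where s: "A s \<noteq> 0"
      using left_canonical_injective_nonzero[OF A] .
    let ?M = "dagger (v j (g \<otimes>\<^bsub>G\<^esub> h)) ** A s ** v (Suc j) (g \<otimes>\<^bsub>G\<^esub> h)"
    \<comment> \<open>Undoing the unitaries recovers \<open>A s\<close>, so \<open>?M\<close> is
      nonzero and can be cancelled.\<close>
    have "v j (g \<otimes>\<^bsub>G\<^esub> h) ** ?M ** dagger (v (Suc j) (g \<otimes>\<^bsub>G\<^esub> h)) = A s"
      using g h j by (simp add: matrix_mul_assoc unitary_mat_cancel uv)
    then have "?M \<noteq> 0"
      using s by auto
    moreover have "(c j g * c j h * (cnj (\<omega> j (g, h)) * \<omega> (Suc j) (g, h))) *\<^sub>m ?M =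
        c j (g \<otimes>\<^bsub>G\<^esub> h) *\<^sub>m ?M"
      using push2[OF g h j, of s] g h j by (simp add: \<omega> mult_ac)
    ultimately have "c j g * c j h * (cnj (\<omega> j (g, h)) * \<omega> (Suc j) (g, h)) = c j (g \<otimes>\<^bsub>G\<^esub> h)"
      by (rule mat_scale_cancel[rotated])
    then have "c j (g \<otimes>\<^bsub>G\<^esub> h) * \<omega> j (g, h) =
        c j g * c j h * \<omega> (Suc j) (g, h) * (\<omega> j (g, h) * cnj (\<omega> j (g, h)))"
      by (simp add: mult_ac)
    also have "\<omega> j (g, h) * cnj (\<omega> j (g, h)) = 1"
      using g h j by (intro cmod_1_cnj \<omega>1) simp_all
    finally have "c j (g \<otimes>\<^bsub>G\<^esub> h) * \<omega> j (g, h) = c j g * c j h * \<omega> (Suc j) (g, h)"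
      by simp
    moreover have "c j g \<noteq> 0" "c j h \<noteq> 0" "c j (g \<otimes>\<^bsub>G\<^esub> h) \<noteq> 0"
      using c(1)[OF g j] c(1)[OF h j] c(1)[OF m_closed[OF g h] j] by auto
    ultimately show "\<omega> (Suc j) (g, h) =
        inverse (c j g) * inverse (c j h) / inverse (c j (g \<otimes>\<^bsub>G\<^esub> h)) * \<omega> j (g, h)"
      by (simp add: field_simps)
  qed
  have cls: "H2_class G (\<omega> j) = H2_class G (\<omega> 0)" if "j \<le> L" for j
    using that by (induction j) (simp_all add: const)

  \<comment> \<open>Invariance of the common class under pullback\<close>
  have "H2_class G (\<omega> (Suc 0)) = H2_class G (pullback G T (\<omega> 0))"
  proof -
    have "\<forall>g. \<exists>z. g \<in> ?C \<longrightarrow> cmod z = 1 \<and> v (Suc 0) g = z *\<^sub>m v 0 (T g)"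
      using shift[of _ 0] L unfolding phase_eq_def by auto
    \<comment> \<open>Covariance at bonds 0 and 1 supplies the phases \<open>b\<close>. Evaluating
      \<open>v (Suc 0) g ** v (Suc 0) h\<close> through \<open>v 0\<close> at \<open>T g\<close> and
      \<open>T h\<close> shows that the cocycle on bond 1 is the pulled-back cocycle of bond 0 times
      the coboundary of \<open>b\<close>.\<close>
    then obtain b where b: "cmod (b g) = 1" "v (Suc 0) g = b g *\<^sub>m v 0 (T g)" if "g \<in> ?C" for g
      by metis
    show ?thesis
    proof (rule H2_class_eqI[OF \<open>group G\<close> pullback_Z2[OF T \<open>group G\<close> Z2] Z2])
      show "b \<in> ?C \<rightarrow> U1"
        by (simp add: b)
      fix g h assume g: "g \<in> ?C" and h: "h \<in> ?C"
      have "(b g * b h * \<omega> 0 (T g, T h)) *\<^sub>m v 0 (T (g \<otimes>\<^bsub>G\<^esub> h)) = v (Suc 0) g ** v (Suc 0) h"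
        using g h by (simp add: b \<omega> hom_mult[OF T] mult_ac)
      also have "\<dots> = (\<omega> (Suc 0) (g, h) * b (g \<otimes>\<^bsub>G\<^esub> h)) *\<^sub>m v 0 (T (g \<otimes>\<^bsub>G\<^esub> h))"
        using \<omega>[OF g h L] b(2)[OF m_closed[OF g h]] by simp
      finally have "b g * b h * \<omega> 0 (T g, T h) = \<omega> (Suc 0) (g, h) * b (g \<otimes>\<^bsub>G\<^esub> h)"
        using g h by (intro mat_scale_cancel) (auto intro!: unitary_mat_nonzero uv)
      moreover have "b (g \<otimes>\<^bsub>G\<^esub> h) \<noteq> 0"
        using b(1)[of "g \<otimes>\<^bsub>G\<^esub> h"] g h by auto
      ultimately show "\<omega> (Suc 0) (g, h) =
          b g * b h / b (g \<otimes>\<^bsub>G\<^esub> h) * pullback G T (\<omega> 0) (g, h)"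
        using g h by (simp add: pullback_def field_simps)
    qed (use L in simp_all)
  qed
  then have pb: "H2_class G (pullback G T (\<omega> 0)) = H2_class G (\<omega> 0)"
    using cls[of "Suc 0"] L by simp

  have "H2_class G (\<omega> 0) \<in> carrier (H2 G)"
    unfolding H2_def H2_class_def FactGroup_def
    using Z.rcosetsI[OF subgroup.subset[OF subgroup_B2[OF \<open>group G\<close>]] Z2[of 0]] by simp
  \<comment> \<open>Invariance is claimed for every representative of the class, so the result for
    bond 0 is transported along \<open>H2_class_pullback\<close>.\<close>
  moreover have "H2_class G (pullback G T \<omega>') = H2_class G (\<omega> 0)" if "\<omega>' \<in> H2_class G (\<omega> 0)" for \<omega>'
    using H2_class_pullback[OF \<open>group G\<close> T Z2[of 0] that] pb by simp
  moreover have "v j g \<doteq> v (j - 1) (T g)" if "g \<in> ?C" "j \<in> {1..L}" for g j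
    using shift[of g "j - 1"] that by (cases j) simp_all
  ultimately show ?thesis
    using Z2 \<omega> cls by (intro conjI exI[of _ \<omega>] bexI[of _ "H2_class G (\<omega> 0)"]) blast+
qed

end
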